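(* Let $\mathcal{G}$ be a connected, undirected graph on the nodes (agents) $\{1,\ldots,n\}$, and let $m$ be an integer with $1\le m\le n$. Let $c_1,\ldots,c_m\in\mathbb{R}$ be constant exogenous inputs, each applied to at least one agent. Consider the networked multiagent system $$\dot{x}_i(t)=-\sum_{i\sim j}\bigl(x_i(t)-x_j(t)\bigr)+\sum_{i\sim j}\bigl(\xi_i(t)-\xi_j(t)\bigr)-\sum_{i\sim h}\bigl(x_i(t)-c_h\bigr),\quad x_i(0)=x_{i0},$$ $$\dot{\xi}_i(t)=-\sum_{i\sim j}\bigl(x_i(t)-x_j(t)\bigr),\quad \xi_i(0)=\xi_{i0},$$ for $i=1,\ldots,n$. Let $$\delta(t)=x(t)-\epsilon\mathbf{1}_n,\qquad e(t)=\xi(t)-\mathcal{L}(\mathcal{G})^\dagger L_cK_2c,$$ with $\epsilon$, $L_c$, $K_1$, $K_2$, $c$ as defined in the context. These errors satisfy the closed-loop error dynamics $$\dot{\delta}(t)=-\bigl(\mathcal{L}(\mathcal{G})+K_1\bigr)\delta(t)+\mathcal{L}(\mathcal{G})e(t),\qquad \dot{e}(t)=-\mathcal{L}(\mathcal{G})\delta(t).$$ Then the closed-loop error dynamics are Lyapunov stable (i.e., the equilibrium $(\delta,e)=(0,0)$ is Lyapunov stable), and for all initial conditions $\delta(t)\to 0$ as $t\to\infty$.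
   Context: The graph $\mathcal{G}$ is simple, undirected and unweighted. The notation $i\sim j$ means that agents $i$ and $j$ are neighbors in $\mathcal{G}$, and $\sum_{i\sim j}$ (for fixed $i$) is a sum over the neighbors $j$ of $i$. The notation $i\sim h$ means that exogenous input $c_h$ is applied to agent $i$, and $\sum_{i\sim h}$ (for fixed $i$) is a sum over all inputs $h\in\{1,\ldots,m\}$ applied to agent $i$ (an empty sum, equal to $0$, if there are none). An agent may receive no input, one input, or several inputs, and an input may be applied to one or several agents. The Laplacian is $\mathcal{L}(\mathcal{G})=\mathcal{D}(\mathcal{G})-\mathcal{A}(\mathcal{G})\in\mathbb{R}^{n\times n}$, where $\mathcal{D}(\mathcal{G})$ is the diagonal matrix of node degrees and $\mathcal{A}(\mathcal{G})$ is the $0/1$ adjacency matrix. $\mathcal{L}(\mathcal{G})^\dagger$ is its Moore–Penrose pseudoinverse. $\mathbf{1}_n\in\mathbb{R}^n$ is the all-ones vector and $\mathrm{I}_n$ is the identity matrix. Write $x(t)=[x_1(t),\ldots,x_n(t)]^{\mathrm T}$, $\xi(t)=[\xi_1(t),\ldots,\xi_n(t)]^{\mathrm T}$, and $c=[c_1,\ldots,c_m,0,\ldots,0]^{\mathrm T}\in\mathbb{R}^n$. $K_2=[k_{2,ih}]\in\mathbb{R}^{n\times n}$ has $k_{2,ih}=1$ if $h\le m$ and $c_h$ is applied to agent $i$, and $k_{2,ih}=0$ otherwise. $K_1=\mathrm{diag}(k_{1,1},\ldots,k_{1,n})$, where $k_{1,i}=\sum_{h=1}^n k_{2,ih}$ is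 the number of exogenous inputs applied to agent $i$. The average of the applied exogenous inputs is $$\epsilon=\frac{\mathbf{1}_n^{\mathrm T}K_2c}{\mathbf{1}_n^{\mathrm T}K_2\mathbf{1}_n}\in\mathbb{R},$$ and $$L_c=\frac{K_1\mathbf{1}_n\mathbf{1}_n^{\mathrm T}}{\mathbf{1}_n^{\mathrm T}K_2\mathbf{1}_n}-\mathrm{I}_n.$$ *)

theory Defs
  imports "HOL-Analysis.Analysis"
begin

text \<open>
  The agents are the elements of a finite type \<open>'n\<close>, so \<open>n = CARD('n)\<close>. The neighbor relation is
  \<open>adj\<close>. A bijection \<open>num\<close> from \<open>'n\<close> onto \<open>{1..n}\<close> numbers the agents; it is only needed because
  the columns of \<open>K\<^sub>2\<close> and the entries of the padded vector \<open>c\<close> are indexed by inputs \<open>h \<in> {1..n}\<close>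
  while they live in spaces indexed by \<open>'n\<close>. The inputs are \<open>c h\<close> for \<open>h \<in> {1..m}\<close>, and
  \<open>app i h\<close> says that input \<open>h\<close> is applied to agent \<open>i\<close>.
\<close>

definition connected_simple_graph :: "('n \<Rightarrow> 'n \<Rightarrow> bool) \<Rightarrow> bool" where
  "connected_simple_graph adj \<longleftrightarrow>
     (\<forall>i. \<not> adj i i) \<and> (\<forall>i j. adj i j \<longrightarrow> adj j i) \<and> (\<forall>i j. adj\<^sup>*\<^sup>* i j)"

definition degree_matrix :: "('n::finite \<Rightarrow> 'n \<Rightarrow> bool) \<Rightarrow> real^'n^'n" where
  "degree_matrix adj = (\<chi> i j. if i = j then real (card {k. adj i k}) else 0)"

definition adjacency_matrix :: "('n::finite \<Rightarrow> 'n \<Rightarrow> bool) \<Rightarrow> real^'n^'n" where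
  "adjacency_matrix adj = (\<chi> i j. if adj i j then 1 else 0)"

definition laplacian :: "('n::finite \<Rightarrow> 'n \<Rightarrow> bool) \<Rightarrow> real^'n^'n" where
  "laplacian adj = degree_matrix adj - adjacency_matrix adj"

definition is_pseudoinverse :: "real^'n^'m \<Rightarrow> real^'m^'n \<Rightarrow> bool" where
  "is_pseudoinverse A X \<longleftrightarrow>
     A ** X ** A = A \<and> X ** A ** X = X \<and>
     transpose (A ** X) = A ** X \<and> transpose (X ** A) = X ** A"

lemma is_pseudoinverse_unique:
  assumes "is_pseudoinverse A X" "is_pseudoinverse A Y"
  shows "X = Y"
proof -
  have "A ** X = transpose (A ** Y ** A ** X)"
    using assms by (simp add: is_pseudoinverse_def)
  also have "\<dots> = transpose (A ** X) ** transpose (A ** Y)"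
    by (simp add: matrix_transpose_mul matrix_mul_assoc)
  also have "\<dots> = A ** X ** A ** Y"
    using assms by (simp add: is_pseudoinverse_def matrix_mul_assoc)
  also have "\<dots> = A ** Y"
    using assms by (simp add: is_pseudoinverse_def)
  finally have AX: "A ** X = A ** Y" .
  have "X ** A = transpose (X ** (A ** Y ** A))"
    using assms by (simp add: is_pseudoinverse_def)
  also have "\<dots> = transpose (Y ** A) ** transpose (X ** A)"
    by (simp add: matrix_transpose_mul matrix_mul_assoc)
  also have "\<dots> = Y ** (A ** X ** A)"
    using assms unfolding is_pseudoinverse_def by (metis matrix_mul_assoc)
  also have "\<dots> = Y ** A"
    using assms by (simp add: is_pseudoinverse_def)
  finally have XA: "X ** A = Y ** A" .
  have "X = X ** (A ** X)"
    using assms by (simp add: is_pseudoinverse_def matrix_mul_assoc)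
  also have "\<dots> = Y ** A ** Y"
    by (simp add: AX XA matrix_mul_assoc)
  also have "\<dots> = Y"
    using assms by (simp add: is_pseudoinverse_def)
  finally show ?thesis .
qed

definition pseudoinverse :: "real^'n^'m \<Rightarrow> real^'m^'n" where
  "pseudoinverse A = (THE X. is_pseudoinverse A X)"

definition input_vector :: "('n::finite \<Rightarrow> nat) \<Rightarrow> nat \<Rightarrow> (nat \<Rightarrow> real) \<Rightarrow> real^'n" where
  "input_vector num m c = (\<chi> j. if num j \<le> m then c (num j) else 0)"

definition K2 :: "('n::finite \<Rightarrow> nat) \<Rightarrow> nat \<Rightarrow> ('n \<Rightarrow> nat \<Rightarrow> bool) \<Rightarrow> real^'n^'n" where
  "K2 num m app = (\<chi> i j. if num j \<le> m \<and> app i (num j) then 1 else 0)"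

definition K1 :: "('n::finite \<Rightarrow> nat) \<Rightarrow> nat \<Rightarrow> ('n \<Rightarrow> nat \<Rightarrow> bool) \<Rightarrow> real^'n^'n" where
  "K1 num m app = (\<chi> i j. if i = j then (\<Sum>h\<in>UNIV. K2 num m app $ i $ h) else 0)"

text \<open>On vectors \<open>1\<close> is the all-ones vector; the identity matrix is \<open>mat 1\<close>.\<close>

definition input_average ::
  "('n::finite \<Rightarrow> nat) \<Rightarrow> nat \<Rightarrow> ('n \<Rightarrow> nat \<Rightarrow> bool) \<Rightarrow> (nat \<Rightarrow> real) \<Rightarrow> real" where
  "input_average num m app c =
     ((1::real^'n) \<bullet> (K2 num m app *v input_vector num m c)) /
     ((1::real^'n) \<bullet> (K2 num m app *v 1))"

definition ones_matrix :: "real^'n^'n" where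
  "ones_matrix = (\<chi> i j. (1::real^'n) $ i * (1::real^'n) $ j)"

definition Lc :: "('n::finite \<Rightarrow> nat) \<Rightarrow> nat \<Rightarrow> ('n \<Rightarrow> nat \<Rightarrow> bool) \<Rightarrow> real^'n^'n" where
  "Lc num m app =
     (1 / ((1::real^'n) \<bullet> (K2 num m app *v 1))) *\<^sub>R (K1 num m app ** ones_matrix) - mat 1"

definition multiagent_solution ::
  "('n::finite \<Rightarrow> 'n \<Rightarrow> bool) \<Rightarrow> nat \<Rightarrow> ('n \<Rightarrow> nat \<Rightarrow> bool) \<Rightarrow> (nat \<Rightarrow> real) \<Rightarrow>
   real^'n \<Rightarrow> real^'n \<Rightarrow> (real \<Rightarrow> real^'n) \<Rightarrow> (real \<Rightarrow> real^'n) \<Rightarrow> bool" where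
  "multiagent_solution adj m app c x0 \<xi>0 x \<xi> \<longleftrightarrow>
     x 0 = x0 \<and> \<xi> 0 = \<xi>0 \<and>
     (\<forall>t\<ge>0. \<forall>i.
        ((\<lambda>s. x s $ i) has_real_derivative
           - (\<Sum>j\<in>{j. adj i j}. x t $ i - x t $ j)
           + (\<Sum>j\<in>{j. adj i j}. \<xi> t $ i - \<xi> t $ j)
           - (\<Sum>h\<in>{h\<in>{1..m}. app i h}. x t $ i - c h)) (at t within {0..}) \<and>
        ((\<lambda>s. \<xi> s $ i) has_real_derivative
           - (\<Sum>j\<in>{j. adj i j}. x t $ i - x t $ j)) (at t within {0..}))"

definition solves_ode_on ::
  "('a::real_normed_vector \<Rightarrow> 'a) \<Rightarrow> (real \<Rightarrow> 'a) \<Rightarrow> real set \<Rightarrow> bool" where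
  "solves_ode_on F z S \<longleftrightarrow> (\<forall>t\<in>S. (z has_vector_derivative F (z t)) (at t within S))"

text \<open>
  Trajectories on all compact intervals \<open>{0..T}\<close>, and not only those on \<open>{0..}\<close>, are considered,
  so that a trajectory with finite escape time would not be ignored.
\<close>

definition lyapunov_stable :: "('a::real_normed_vector \<Rightarrow> 'a) \<Rightarrow> 'a \<Rightarrow> bool" where
  "lyapunov_stable F p \<longleftrightarrow>
     F p = 0 \<and>
     (\<forall>\<epsilon>>0. \<exists>\<eta>>0. \<forall>T\<ge>0. \<forall>z. solves_ode_on F z {0..T} \<and> dist (z 0) p < \<eta> \<longrightarrow>
        (\<forall>t\<in>{0..T}. dist (z t) p < \<epsilon>))"

definition error_dynamics ::
  "('n::finite \<Rightarrow> 'n \<Rightarrow> bool) \<Rightarrow> ('n \<Rightarrow> nat) \<Rightarrow> nat \<Rightarrow> ('n \<Rightarrow> nat \<Rightarrow> bool) \<Rightarrow>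
   (real^'n) \<times> (real^'n) \<Rightarrow> (real^'n) \<times> (real^'n)" where
  "error_dynamics adj num m app = (\<lambda>(\<delta>, e).
     (- ((laplacian adj + K1 num m app) *v \<delta>) + laplacian adj *v e,
      - (laplacian adj *v \<delta>)))"

end

theory Submission
  imports Defs
begin

text \<open>
  The Laplacian \<open>L\<close> is positive semidefinite with kernel spanned by the all-ones vector, and \<open>K\<^sub>1\<close> is a
  nonzero nonnegative diagonal matrix, so \<open>L + K\<^sub>1\<close> is positive definite. As \<open>L\<close> is symmetric, its
  cross terms cancel in the derivative of \<open>V = \<parallel>\<delta>\<parallel>\<^sup>2 + \<parallel>e\<parallel>\<^sup>2\<close>, leaving
  \<open>V' = - 2 \<delta> \<bullet> (L + K\<^sub>1) \<delta> \<le> - 2 \<mu> \<parallel>\<delta>\<parallel>\<^sup>2\<close>. Hence the norm of a trajectory never grows, which is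
  stability; trajectories are therefore bounded, hence Lipschitz, and a Barbalat argument gives
  \<open>\<delta> \<rightarrow> 0\<close>. The error equations themselves rest on \<open>L L\<^sup>\<dagger> v = v\<close> for \<open>v\<close> orthogonal to
  the all-ones vector, which \<open>L\<^sub>c K\<^sub>2 c\<close> is.
\<close>

section \<open>The graph Laplacian and its quadratic form\<close>

lemma laplacian_mult_component:
  "(laplacian adj *v x) $ i = (\<Sum>j\<in>{j. adj i j}. x $ i - x $ j)"
proof -
  have "(laplacian adj *v x) $ i
      = (\<Sum>j\<in>UNIV. if i = j then real (card {k. adj i k}) * x $ j else 0)
        - (\<Sum>j\<in>UNIV. if adj i j then x $ j else 0)"
    unfolding sum_subtractf[symmetric] laplacian_def degree_matrix_def adjacency_matrix_def
      matrix_vector_mult_def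
    by (auto intro!: sum.cong simp: algebra_simps)
  also have "\<dots> = real (card {k. adj i k}) * x $ i - (\<Sum>j\<in>{j. adj i j}. x $ j)"
    by (simp add: sum.delta' sum.If_cases)
  finally show ?thesis by (simp add: sum_subtractf)
qed

lemma transpose_laplacian:
  assumes "\<And>i j. adj i j \<Longrightarrow> adj j i"
  shows "transpose (laplacian adj) = laplacian adj"
  using assms
  by (auto simp: laplacian_def degree_matrix_def adjacency_matrix_def transpose_def vec_eq_iff)

lemma laplacian_one: "laplacian adj *v 1 = 0"
  by (simp add: vec_eq_iff laplacian_mult_component)

lemma inner_symmetric_matrix:
  fixes A :: "real^'n^'n"
  assumes "transpose A = A"
  shows "x \<bullet> (A *v y) = (A *v x) \<bullet> y"
  using dot_lmul_matrix[of x A y] assms by (metis transpose_matrix_vector)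

text \<open>Symmetry of \<open>adj\<close> allows the two summation indices to be swapped; adding
  the two resulting expressions for the form completes the square. The factor 2 is there because
  each edge is counted in both directions.\<close>

lemma laplacian_quadratic_form:
  assumes sym: "\<And>i j. adj i j \<Longrightarrow> adj j i"
  shows "2 * (x \<bullet> (laplacian adj *v x))
    = (\<Sum>i\<in>UNIV. \<Sum>j\<in>{j. adj i j}. (x $ i - x $ j)\<^sup>2)"
proof -
  define S where "S = (\<Sum>i\<in>UNIV. \<Sum>j\<in>UNIV. if adj i j then x $ i * (x $ i - x $ j) else 0)"
  have S: "x \<bullet> (laplacian adj *v x) = S"
    by (simp add: S_def inner_vec_def laplacian_mult_component sum_distrib_left
        sum.If_cases)
  have S': "S = (\<Sum>i\<in>UNIV. \<Sum>j\<in>UNIV. if adj i j then x $ j * (x $ j - x $ i) else 0)"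
    unfolding S_def by (subst sum.swap) (use sym in \<open>auto intro!: sum.cong\<close>)
  have "S + S = (\<Sum>i\<in>UNIV. \<Sum>j\<in>UNIV. if adj i j then (x $ i - x $ j)\<^sup>2 else 0)"
    unfolding S'
    by (subst S'[symmetric], unfold S_def sum.distrib[symmetric])
      (auto intro!: sum.cong simp: power2_eq_square algebra_simps)
  then show ?thesis
    by (simp add: S sum.If_cases)
qed

lemma laplacian_nonneg:
  assumes "\<And>i j. adj i j \<Longrightarrow> adj j i"
  shows "0 \<le> x \<bullet> (laplacian adj *v x)"
  using laplacian_quadratic_form[of adj x] assms
  by (smt (verit, ccfv_SIG) sum_nonneg zero_le_power2)

text \<open>A vanishing sum of squares forces equal entries across every edge, and connectedness
  carries this equality along paths.\<close>

lemma laplacian_definite: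
  assumes graph: "connected_simple_graph adj"
    and zero: "x \<bullet> (laplacian adj *v x) = 0"
  shows "x $ i = x $ j"
proof -
  have sym: "\<And>i j. adj i j \<Longrightarrow> adj j i" and conn: "adj\<^sup>*\<^sup>* i j"
    using graph by (auto simp: connected_simple_graph_def)
  have "(\<Sum>i\<in>UNIV. \<Sum>j\<in>{j. adj i j}. (x $ i - x $ j)\<^sup>2) = 0"
    using laplacian_quadratic_form[of adj x] sym zero by simp
  then have "\<forall>i. (\<Sum>j\<in>{j. adj i j}. (x $ i - x $ j)\<^sup>2) = 0"
    by (subst (asm) sum_nonneg_eq_0_iff) (auto intro: sum_nonneg)
  then have "\<forall>i. \<forall>j. adj i j \<longrightarrow> (x $ i - x $ j)\<^sup>2 = 0"
    by (subst (asm) sum_nonneg_eq_0_iff) auto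
  then have step: "\<And>i j. adj i j \<Longrightarrow> x $ i = x $ j"
    by simp
  show ?thesis
    using conn by (induction rule: rtranclp_induct) (use step in auto)
qed

section \<open>Coercivity of positive definite matrices\<close>

text \<open>The form attains its minimum on the compact unit sphere; this minimum serves as \<mu>,
  and homogeneity of degree two extends the bound to all vectors.\<close>

lemma matrix_coercive:
  fixes A :: "real^'n^'n"
  assumes "\<And>x. x \<noteq> 0 \<Longrightarrow> 0 < x \<bullet> (A *v x)"
  obtains \<mu> where "0 < \<mu>" "\<And>x. \<mu> * (norm x)\<^sup>2 \<le> x \<bullet> (A *v x)"
proof -
  have "\<exists>u\<in>sphere 0 1. \<forall>y\<in>sphere 0 1. u \<bullet> (A *v u) \<le> y \<bullet> (A *v y)"
    by (intro continuous_attains_inf continuous_on_inner continuous_on_id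
        linear_continuous_on[OF matrix_vector_mul_bounded_linear]) auto
  then obtain u :: "real^'n" where u: "norm u = 1"
    "\<And>y. norm y = 1 \<Longrightarrow> u \<bullet> (A *v u) \<le> y \<bullet> (A *v y)"
    by auto
  show thesis
  proof
    show "0 < u \<bullet> (A *v u)" using assms[of u] u(1) by fastforce
    fix x :: "real^'n"
    show "u \<bullet> (A *v u) * (norm x)\<^sup>2 \<le> x \<bullet> (A *v x)"
    proof (cases "x = 0")
      case False
      have "u \<bullet> (A *v u) \<le> (x /\<^sub>R norm x) \<bullet> (A *v (x /\<^sub>R norm x))"
        using False by (intro u(2)) simp
      also have "\<dots> = (x \<bullet> (A *v x)) / (norm x)\<^sup>2"
        by (simp add: matrix_vector_mult_scaleR power2_eq_square divide_inverse)
      finally show ?thesis using False by (simp add: field_simps)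
    qed simp
  qed
qed

section \<open>The pseudoinverse of the Laplacian\<close>

lemma pseudoinverse_eqI:
  assumes "is_pseudoinverse A X"
  shows "pseudoinverse A = X"
  unfolding pseudoinverse_def using assms is_pseudoinverse_unique by blast

lemma ones_matrix_mult: "ones_matrix *v x = (1 \<bullet> x) *\<^sub>R 1"
  by (simp add: ones_matrix_def matrix_vector_mult_def vec_eq_iff inner_vec_def)

text \<open>With \<open>P = ones_matrix / n\<close> the orthogonal projection onto the kernel of the Laplacian \<open>L\<close>,
  the matrix \<open>L + P\<close> is invertible and \<open>(L + P)\<inverse> - P\<close> is the pseudoinverse of \<open>L\<close>.\<close>

lemma laplacian_mult_pseudoinverse:
  fixes adj :: "'n::finite \<Rightarrow> 'n \<Rightarrow> bool"
  assumes graph: "connected_simple_graph adj"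
    and orth: "1 \<bullet> v = 0"
  shows "laplacian adj *v (pseudoinverse (laplacian adj) *v v) = v"
proof -
  define L where "L = laplacian adj"
  define P :: "real^'n^'n" where "P = (1 / real CARD('n)) *\<^sub>R ones_matrix"
  define M where "M = L + P"
  have sym: "\<And>i j. adj i j \<Longrightarrow> adj j i"
    using graph by (auto simp: connected_simple_graph_def)
  have Lt: "transpose L = L"
    unfolding L_def using sym by (rule transpose_laplacian)
  have Pt: "transpose P = P"
    by (simp add: P_def ones_matrix_def transpose_def vec_eq_iff)
  have Pv: "P *v x = ((1 \<bullet> x) / real CARD('n)) *\<^sub>R 1" for x
    by (simp add: P_def scaleR_matrix_vector_assoc[symmetric] ones_matrix_mult)
  have one_one: "(1::real^'n) \<bullet> 1 = real CARD('n)"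
    by (simp add: inner_vec_def)
  have PP: "P ** P = P"
    by (simp add: matrix_eq matrix_vector_mul_assoc[symmetric] Pv one_one)
  have LP: "L ** P = 0"
    by (simp add: matrix_eq matrix_vector_mul_assoc[symmetric] Pv L_def
        matrix_vector_mult_scaleR laplacian_one)
  have PL: "P ** L = 0"
    using arg_cong[OF LP, of transpose]
    by (simp add: matrix_transpose_mul Lt Pt) (simp add: transpose_def vec_eq_iff)
  \<comment> \<open>Pairing \<open>M *v x\<close> with \<open>x\<close> gives two nonnegative terms,
    so both vanish: the Laplacian term makes \<open>x\<close> constant, and the \<open>P\<close>
    term makes its entries sum to zero.\<close>
  have "x = 0" if "M *v x = 0" for x
  proof -
    have "x \<bullet> (L *v x) + (1 \<bullet> x)\<^sup>2 / real CARD('n) = 0"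
      using arg_cong[OF that, of "\<lambda>y. x \<bullet> y"]
      by (simp add: M_def matrix_vector_mult_add_rdistrib inner_add_right Pv inner_commute
          power2_eq_square)
    moreover have "0 \<le> x \<bullet> (L *v x)"
      unfolding L_def using sym by (rule laplacian_nonneg)
    moreover have "0 \<le> (1 \<bullet> x)\<^sup>2 / real CARD('n)" by simp
    ultimately have zero: "x \<bullet> (L *v x) = 0" "(1 \<bullet> x)\<^sup>2 / real CARD('n) = 0"
      by linarith+
    have "1 \<bullet> x = (\<Sum>j\<in>(UNIV::'n set). x $ i)" for i
      unfolding inner_vec_def
      by (intro sum.cong refl)
        (use laplacian_definite[OF graph zero(1)[unfolded L_def]] in auto)
    with zero(2) show ?thesis by (simp add: vec_eq_iff)
  qed
  then obtain N where NM: "N ** M = mat 1"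
    using matrix_left_invertible_ker[of M] by blast
  then have MN: "M ** N = mat 1"
    by (simp add: matrix_left_right_inverse)
  have MP: "M ** P = P"
    by (simp add: M_def matrix_eq matrix_vector_mul_assoc[symmetric]
        matrix_vector_mult_add_rdistrib) (simp add: matrix_vector_mul_assoc LP PP)
  have NP: "N ** P = P"
    by (metis MP NM matrix_mul_assoc matrix_mul_lid)
  have PN: "P ** N = P"
    by (metis M_def MN PL PP add.left_neutral matrix_add_ldistrib matrix_mul_assoc matrix_mul_rid)
  have diff: "(A - B) ** C = A ** C - B ** C" "C ** (A - B) = C ** A - C ** B"
    for A B C :: "real^'n^'n"
    by (simp_all add: matrix_matrix_mult_def vec_eq_iff algebra_simps sum_subtractf)
  have L: "L = M - P" by (simp add: M_def)
  \<comment> \<open>Both products turn out to be the symmetric projection \<open>mat 1 - P\<close>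
    along the constants, from which all four Penrose equations follow.\<close>
  have Lx: "L ** (N - P) = mat 1 - P"
    using LP by (simp add: diff L MN PN)
  have xL: "(N - P) ** L = mat 1 - P"
    using PL by (simp add: diff L NM NP)
  have "is_pseudoinverse L (N - P)"
    unfolding is_pseudoinverse_def
  proof (intro conjI)
    show "L ** (N - P) ** L = L" unfolding Lx by (simp add: diff PL)
    show "(N - P) ** L ** (N - P) = N - P" unfolding xL by (simp add: diff PN PP)
    have "transpose (mat 1 - P) = mat 1 - P"
      using Pt by (simp add: transpose_def vec_eq_iff mat_def)
    then show "transpose (L ** (N - P)) = L ** (N - P)" "transpose ((N - P) ** L) = (N - P) ** L"
      by (simp_all add: Lx xL)
  qed
  then have "pseudoinverse L = N - P" by (rule pseudoinverse_eqI)
  then have "L *v (pseudoinverse L *v v) = (mat 1 - P) *v v"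
    by (simp add: matrix_vector_mul_assoc Lx)
  also have "\<dots> = v"
    by (simp add: matrix_vector_mult_diff_rdistrib Pv orth)
  finally show ?thesis by (simp add: L_def)
qed

section \<open>The input matrices \<open>K1\<close> and \<open>K2\<close>\<close>

text \<open>Reindexing along \<open>num\<close> turns columns into inputs, and
  \<open>m \<le> CARD('n)\<close> ensures that no input is cut off. This ties the rows of
  \<open>K2\<close> to the input sums in the agents' equations.\<close>

lemma sum_over_inputs:
  fixes num :: "'n::finite \<Rightarrow> nat" and f :: "nat \<Rightarrow> real"
  assumes numbering: "bij_betw num UNIV {1..CARD('n)}" and m: "m \<le> CARD('n)"
  shows "(\<Sum>j\<in>UNIV. if num j \<le> m \<and> app i (num j) then f (num j) else 0)
    = (\<Sum>h\<in>{h\<in>{1..m}. app i h}. f h)"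
proof -
  have "(\<Sum>j\<in>UNIV. if num j \<le> m \<and> app i (num j) then f (num j) else 0)
      = (\<Sum>h\<in>{1..CARD('n)}. if h \<le> m \<and> app i h then f h else 0)"
    by (rule sum.reindex_bij_betw[OF numbering])
  also have "\<dots> = (\<Sum>h\<in>{h\<in>{1..CARD('n)}. h \<le> m \<and> app i h}. f h)"
    by (rule sum.inter_filter[symmetric]) simp
  also have "{h\<in>{1..CARD('n)}. h \<le> m \<and> app i h} = {h\<in>{1..m}. app i h}"
    using m by auto
  finally show ?thesis .
qed

text \<open>The row sums of \<open>K2\<close> are written as \<open>K2 num m app *v 1\<close>, the
  form in which they enter \<open>input_average\<close> and \<open>Lc\<close>.\<close>

lemma K1_mult_component: "(K1 num m app *v x) $ i = (K2 num m app *v 1) $ i * x $ i"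
  by (simp add: K1_def matrix_vector_mult_def if_distrib[of "\<lambda>a. a * _"] cong: if_cong)

lemma K1_one: "K1 num m app *v 1 = K2 num m app *v 1"
  by (simp add: vec_eq_iff K1_mult_component)

lemma K2_one_component:
  fixes num :: "'n::finite \<Rightarrow> nat"
  assumes "bij_betw num UNIV {1..CARD('n)}" "m \<le> CARD('n)"
  shows "(K2 num m app *v 1) $ i = real (card {h\<in>{1..m}. app i h})"
  using sum_over_inputs[OF assms, of app i "\<lambda>_. 1"]
  by (simp add: K2_def matrix_vector_mult_def)

lemma K2_input_vector_component:
  fixes num :: "'n::finite \<Rightarrow> nat"
  assumes "bij_betw num UNIV {1..CARD('n)}" "m \<le> CARD('n)"
  shows "(K2 num m app *v input_vector num m c) $ i = (\<Sum>h\<in>{h\<in>{1..m}. app i h}. c h)"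
proof -
  have "(K2 num m app *v input_vector num m c) $ i
      = (\<Sum>j\<in>UNIV. if num j \<le> m \<and> app i (num j) then c (num j) else 0)"
    by (auto intro!: sum.cong simp: K2_def input_vector_def matrix_vector_mult_def)
  then show ?thesis using sum_over_inputs[OF assms] by simp
qed

lemma K1_quadratic_form:
  "x \<bullet> (K1 num m app *v x) = (\<Sum>i\<in>UNIV. (K2 num m app *v 1) $ i * (x $ i)\<^sup>2)"
  by (simp add: inner_vec_def K1_mult_component power2_eq_square mult_ac)

text \<open>A single agent \<open>k\<close> with an input is enough. If \<open>x $ k\<close> is
  nonzero, the \<open>K1\<close> term at \<open>k\<close> is positive; otherwise the nonzero
  \<open>x\<close> is not constant, and the Laplacian term is positive.\<close>

lemma laplacian_plus_K1_pos:
  fixes adj :: "'n::finite \<Rightarrow> 'n \<Rightarrow> bool"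
  assumes graph: "connected_simple_graph adj"
    and numbering: "bij_betw num UNIV {1..CARD('n)}"
    and m: "m \<le> CARD('n)"
    and app: "h \<in> {1..m}" "app k h"
    and "x \<noteq> 0"
  shows "0 < x \<bullet> ((laplacian adj + K1 num m app) *v x)"
proof -
  let ?r = "\<lambda>i. (K2 num m app *v 1) $ i"
  have r: "0 \<le> ?r i" for i
    by (simp add: K2_one_component[OF numbering m])
  have rk: "0 < ?r k"
    using app by (auto simp: K2_one_component[OF numbering m] card_gt_0_iff)
  have sym: "\<And>i j. adj i j \<Longrightarrow> adj j i"
    using graph by (auto simp: connected_simple_graph_def)
  have K: "?r k * (x $ k)\<^sup>2 \<le> x \<bullet> (K1 num m app *v x)"
    unfolding K1_quadratic_form
    by (rule member_le_sum) (use r in auto)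
  have L: "0 \<le> x \<bullet> (laplacian adj *v x)"
    using sym by (rule laplacian_nonneg)
  have "0 < x \<bullet> (laplacian adj *v x) + ?r k * (x $ k)\<^sup>2"
  proof (cases "x $ k = 0")
    case True
    then have "x \<bullet> (laplacian adj *v x) \<noteq> 0"
      using laplacian_definite[OF graph, of x _ k] \<open>x \<noteq> 0\<close> by (auto simp: vec_eq_iff)
    then show ?thesis using L True by simp
  next
    case False
    then show ?thesis using L rk by (intro add_nonneg_pos) auto
  qed
  then show ?thesis
    using K by (simp add: matrix_vector_mult_add_rdistrib inner_add_right)
qed

section \<open>From the agents' equations to the error equations\<close>

lemma has_vector_derivative_componentwise:
  fixes f :: "real \<Rightarrow> real^'n"
  shows "(f has_vector_derivative f') (at t within S)
    \<longleftrightarrow> (\<forall>i. ((\<lambda>s. f s $ i) has_real_derivative f' $ i) (at t within S))"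
  unfolding has_vector_derivative_def has_field_derivative_def
  by (subst has_derivative_componentwise_within)
    (simp add: Basis_vec_def inner_axis mult_commute_abs)

text \<open>The shifts move an equilibrium to the origin: \<open>L\<close> annihilates constants,
  \<open>K *v 1 = r\<close> and \<open>L *v w = a *\<^sub>R r - b\<close>, so the constant input
  term \<open>b\<close> cancels.\<close>

lemma error_dynamics_of_solution:
  fixes adj :: "'n::finite \<Rightarrow> 'n \<Rightarrow> bool" and c :: "nat \<Rightarrow> real"
  assumes graph: "connected_simple_graph adj"
    and numbering: "bij_betw num UNIV {1..CARD('n)}"
    and m: "m \<le> CARD('n)"
    and app: "h \<in> {1..m}" "app k h"
    and sol: "multiagent_solution adj m app c x0 \<xi>0 x \<xi>"
  defines "w \<equiv> pseudoinverse (laplacian adj) *v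
    (Lc num m app *v (K2 num m app *v input_vector num m c))"
  shows "solves_ode_on (error_dynamics adj num m app)
    (\<lambda>t. (x t - input_average num m app c *\<^sub>R 1, \<xi> t - w)) {0..}"
proof -
  define L where "L = laplacian adj"
  define K where "K = K1 num m app"
  define r where "r = K2 num m app *v (1::real^'n)"
  define b where "b = K2 num m app *v input_vector num m c"
  define s where "s = 1 \<bullet> r"
  define a where "a = input_average num m app c"
  have a: "a = (1 \<bullet> b) / s"
    by (simp add: a_def input_average_def b_def s_def r_def)
  have r: "r $ i = real (card {h\<in>{1..m}. app i h})" for i
    by (simp add: r_def K2_one_component[OF numbering m])
  \<comment> \<open>The total number \<open>s\<close> of input applications is the denominator of
    the average \<open>a\<close>; agent \<open>k\<close> makes it nonzero.\<close>
  have "0 < r $ k"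
    using app by (auto simp: r card_gt_0_iff)
  also have "r $ k \<le> s"
    unfolding s_def inner_vec_def by (simp, rule member_le_sum) (auto simp: r)
  finally have s: "s \<noteq> 0" by simp
  have Lcb: "Lc num m app *v b = a *\<^sub>R r - b"
    by (simp add: Lc_def matrix_vector_mult_diff_rdistrib scaleR_matrix_vector_assoc[symmetric]
        matrix_vector_mul_assoc[symmetric] ones_matrix_mult matrix_vector_mult_scaleR K1_one
        r_def[symmetric] s_def[symmetric] a)
  \<comment> \<open>The average \<open>a\<close> is exactly the scalar that makes this vector
    orthogonal to the constants, hence reachable by \<open>L\<close>.\<close>
  have "1 \<bullet> (a *\<^sub>R r - b) = 0"
    using s by (simp add: inner_diff_right s_def[symmetric] a)
  then have Lw: "L *v w = a *\<^sub>R r - b"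
    unfolding w_def b_def[symmetric] Lcb L_def by (rule laplacian_mult_pseudoinverse[OF graph])
  have L1: "L *v 1 = 0" by (simp add: L_def laplacian_one)
  have K1: "K *v 1 = r" by (simp add: K_def r_def K1_one)
  have x: "(x has_vector_derivative - (L *v x t) + L *v \<xi> t - (K *v x t - b)) (at t within {0..})"
    and \<xi>: "(\<xi> has_vector_derivative - (L *v x t)) (at t within {0..})" if "0 \<le> t" for t
  proof -
    have "(K *v y - b) $ i = (\<Sum>h\<in>{h\<in>{1..m}. app i h}. y $ i - c h)" for y i
      by (simp add: K_def b_def K1_mult_component K2_input_vector_component[OF numbering m]
          r_def[symmetric] r sum_subtractf)
    then have
      "(- (L *v x t) + L *v \<xi> t - (K *v x t - b)) $ i =
        - (\<Sum>j\<in>{j. adj i j}. x t $ i - x t $ j) + (\<Sum>j\<in>{j. adj i j}. \<xi> t $ i - \<xi> t $ j)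
        - (\<Sum>h\<in>{h\<in>{1..m}. app i h}. x t $ i - c h)"
      "(- (L *v x t)) $ i = - (\<Sum>j\<in>{j. adj i j}. x t $ i - x t $ j)" for i
      by (simp_all only: L_def laplacian_mult_component vector_minus_component
          vector_add_component vector_uminus_component)
    then show "(x has_vector_derivative - (L *v x t) + L *v \<xi> t - (K *v x t - b)) (at t within {0..})"
      "(\<xi> has_vector_derivative - (L *v x t)) (at t within {0..})"
      using sol that unfolding multiagent_solution_def has_vector_derivative_componentwise
      by presburger+
  qed
  show ?thesis
    unfolding solves_ode_on_def
  proof
    fix t :: real assume "t \<in> {0..}"
    then have t: "0 \<le> t" by simp
    have E: "error_dynamics adj num m app (x t - a *\<^sub>R 1, \<xi> t - w)
        = (- (L *v x t) + L *v \<xi> t - (K *v x t - b), - (L *v x t))"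
      by (simp add: error_dynamics_def L_def[symmetric] K_def[symmetric]
          matrix_vector_mult_add_rdistrib matrix_vector_mult_diff_distrib
          matrix_vector_mult_scaleR L1 K1 Lw algebra_simps)
    show "((\<lambda>t. (x t - input_average num m app c *\<^sub>R 1, \<xi> t - w)) has_vector_derivative
        error_dynamics adj num m app (x t - input_average num m app c *\<^sub>R 1, \<xi> t - w))
        (at t within {0..})"
      unfolding a_def[symmetric] E
      by (intro has_vector_derivative_Pair)
        (auto intro!: derivative_eq_intros x[OF t] \<xi>[OF t])
  qed
qed

section \<open>Energy dissipation and convergence\<close>

text \<open>The second component of \<open>z\<close> is absent from the dissipation, so the squared
  norm is not a strict Lyapunov function; this is why convergence calls for a Barbalat
  argument.\<close>

lemma error_dynamics_energy:
  fixes adj :: "'n::finite \<Rightarrow> 'n \<Rightarrow> bool"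
  assumes sym: "\<And>i j. adj i j \<Longrightarrow> adj j i"
  shows "z \<bullet> error_dynamics adj num m app z
    = - (fst z \<bullet> ((laplacian adj + K1 num m app) *v fst z))"
proof -
  obtain d e where z: "z = (d, e)" by fastforce
  have "e \<bullet> (laplacian adj *v d) = d \<bullet> (laplacian adj *v e)"
    using inner_symmetric_matrix[OF transpose_laplacian, of adj e d] sym
    by (simp add: inner_commute)
  then show ?thesis
    by (simp add: z error_dynamics_def inner_diff_right)
qed

lemma solves_ode_on_norm_derivative:
  fixes z :: "real \<Rightarrow> 'a::real_inner"
  assumes "solves_ode_on F z S" "t \<in> S"
  shows "((\<lambda>t. (norm (z t))\<^sup>2) has_real_derivative 2 * (z t \<bullet> F (z t))) (at t within S)"
proof -
  have z: "(z has_derivative (\<lambda>h. h *\<^sub>R F (z t))) (at t within S)"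
    using assms by (simp add: solves_ode_on_def has_vector_derivative_def)
  show ?thesis
    unfolding power2_norm_eq_inner has_field_derivative_def
    by (rule has_derivative_eq_rhs[OF has_derivative_inner[OF z z]])
      (auto simp: inner_commute fun_eq_iff)
qed

lemma has_real_derivative_nonpos_imp_decr:
  fixes f :: "real \<Rightarrow> real"
  assumes "\<And>t. t \<in> {a..b} \<Longrightarrow> (f has_real_derivative f' t) (at t within {a..b})"
    and "\<And>t. t \<in> {a..b} \<Longrightarrow> f' t \<le> 0" and "a \<le> b"
  shows "f b \<le> f a"
proof -
  have "\<exists>t\<in>{a..b}. f b - f a = f' t * (b - a)"
    using assms(1) by (intro mvt_very_simple[OF \<open>a \<le> b\<close>]) (auto simp: has_field_derivative_def)
  then show ?thesis
    using assms(2,3) by (smt (verit) mult_nonpos_nonneg)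
qed

text \<open>The derivative of the squared norm is twice \<open>z \<bullet> F z\<close>. The set
  \<open>S\<close> is left general to cover both \<open>{0..T}\<close> for stability and
  \<open>{0..}\<close> for convergence.\<close>

lemma norm_antimono_of_dissipative:
  fixes z :: "real \<Rightarrow> 'a::real_inner"
  assumes ode: "solves_ode_on F z S" and diss: "\<And>z. z \<bullet> F z \<le> 0"
    and "a \<le> b" "{a..b} \<subseteq> S"
  shows "norm (z b) \<le> norm (z a)"
proof -
  have "(norm (z b))\<^sup>2 \<le> (norm (z a))\<^sup>2"
  proof (rule has_real_derivative_nonpos_imp_decr[where f = "\<lambda>t. (norm (z t))\<^sup>2"])
    fix t assume t: "t \<in> {a..b}"
    show "((\<lambda>t. (norm (z t))\<^sup>2) has_real_derivative 2 * (z t \<bullet> F (z t))) (at t within {a..b})"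
      using solves_ode_on_norm_derivative[OF ode, of t] t assms(4) has_field_derivative_subset
      by blast
    show "2 * (z t \<bullet> F (z t)) \<le> 0" using diss[of "z t"] by simp
  qed (use assms in auto)
  then show ?thesis by (simp add: power2_le_iff_abs_le)
qed

text \<open>A form of Barbalat's lemma: whenever \<open>\<delta>\<close> is not small, the Lipschitz bound keeps it so for a
  fixed time, over which \<open>V\<close> drops by a fixed amount; a convergent \<open>V\<close> drops that
  much only finitely often.\<close>

lemma tendsto_zero_of_lyapunov:
  fixes \<delta> :: "real \<Rightarrow> 'a::real_normed_vector" and V V' :: "real \<Rightarrow> real"
  assumes deriv: "\<And>t. 0 \<le> t \<Longrightarrow> (V has_real_derivative V' t) (at t within {0..})"
    and decay: "\<And>t. 0 \<le> t \<Longrightarrow> V' t \<le> - \<mu> * (norm (\<delta> t))\<^sup>2"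
    and nonneg: "\<And>t. 0 \<le> t \<Longrightarrow> 0 \<le> V t"
    and lipschitz: "C-lipschitz_on {0..} \<delta>"
    and "0 < \<mu>"
  shows "(\<delta> \<longlongrightarrow> 0) at_top"
proof -
  have drop: "V b - V a \<le> - \<kappa> * (b - a)"
    if "0 \<le> a" "a \<le> b" "\<And>t. a \<le> t \<Longrightarrow> t \<le> b \<Longrightarrow> V' t \<le> - \<kappa>" for a b \<kappa>
  proof -
    have "V b + \<kappa> * b \<le> V a + \<kappa> * a"
    proof (rule has_real_derivative_nonpos_imp_decr[where f = "\<lambda>t. V t + \<kappa> * t"])
      fix t assume t: "t \<in> {a..b}"
      have "(V has_real_derivative V' t) (at t within {a..b})"
        using deriv[of t] t that(1) by (auto intro: has_field_derivative_subset)
      then show "((\<lambda>t. V t + \<kappa> * t) has_real_derivative V' t + \<kappa>) (at t within {a..b})"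
        by (auto intro!: derivative_eq_intros)
      show "V' t + \<kappa> \<le> 0" using that(3)[of t] t by simp
    qed (use that in auto)
    then show ?thesis by (simp add: algebra_simps)
  qed
  define l where "l = Inf (V ` {0..})"
  have bdd: "bdd_below (V ` {0..})" using nonneg by (auto intro!: bdd_belowI2)
  have l: "l \<le> V t" if "0 \<le> t" for t
    unfolding l_def using that by (intro cInf_lower bdd) auto
  have antimono: "V b \<le> V a" if "0 \<le> a" "a \<le> b" for a b
    using drop[of a b 0] that decay \<open>0 < \<mu>\<close>
    by (smt (verit) mult_nonneg_nonneg mult_minus_left zero_le_power2 mult_zero_left)
  \<comment> \<open>A strictly positive bound, since \<open>C\<close> may be 0 and \<tau> divides by
    it.\<close>
  define B where "B = C + 1"
  have B: "0 < B" using lipschitz_on_nonneg[OF lipschitz] by (simp add: B_def)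
  show ?thesis
    unfolding tendsto_iff
  proof (intro allI impI)
    fix \<epsilon> :: real assume "0 < \<epsilon>"
    \<comment> \<open>Within time \<tau> the function \<delta> moves by at most \<epsilon>/2, so
      from norm at least \<epsilon> it keeps norm at least \<epsilon>/2; meanwhile \<open>V\<close>
      falls at rate at least \<kappa>.\<close>
    define \<tau> where "\<tau> = \<epsilon> / (2 * B)"
    define \<kappa> where "\<kappa> = \<mu> * (\<epsilon> / 2)\<^sup>2"
    have pos: "0 < \<tau>" "0 < \<kappa>" using \<open>0 < \<epsilon>\<close> \<open>0 < \<mu>\<close> B by (auto simp: \<tau>_def \<kappa>_def)
    \<comment> \<open>From time \<open>s\<close> on, \<open>V\<close> is too close to its infimum to
      afford another drop of \<open>\<kappa> * \<tau>\<close>.\<close>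
    have "Inf (V ` {0..}) < l + \<kappa> * \<tau>" using pos by (simp add: l_def)
    then obtain s where s: "0 \<le> s" "V s < l + \<kappa> * \<tau>"
      using cInf_lessD[of "V ` {0..}"] by auto
    show "\<forall>\<^sub>F t in at_top. dist (\<delta> t) 0 < \<epsilon>"
    proof (rule eventually_at_top_linorderI)
      fix t assume "s \<le> t"
      show "dist (\<delta> t) 0 < \<epsilon>"
      proof (rule ccontr)
        assume "\<not> dist (\<delta> t) 0 < \<epsilon>"
        then have big: "\<epsilon> \<le> norm (\<delta> t)" by simp
        have "V' u \<le> - \<kappa>" if u: "t \<le> u" "u \<le> t + \<tau>" for u
        proof -
          have "norm (\<delta> t - \<delta> u) \<le> C * (u - t)"
            using lipschitz_onD[OF lipschitz, of t u] u s(1) \<open>s \<le> t\<close> by (simp add: dist_norm)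
          also have "\<dots> \<le> B * \<tau>"
            using u pos lipschitz_on_nonneg[OF lipschitz] by (intro mult_mono) (auto simp: B_def)
          also have "\<dots> = \<epsilon> / 2" using B by (simp add: \<tau>_def)
          finally have "norm (\<delta> t - \<delta> u) \<le> \<epsilon> / 2" .
          with big have "\<epsilon> / 2 \<le> norm (\<delta> u)"
            using norm_triangle_ineq2[of "\<delta> t" "\<delta> u"] by linarith
          then have "\<kappa> \<le> \<mu> * (norm (\<delta> u))\<^sup>2"
            unfolding \<kappa>_def using \<open>0 < \<mu>\<close> \<open>0 < \<epsilon>\<close> by (intro mult_left_mono power_mono) auto
          then show ?thesis using decay[of u] u s(1) \<open>s \<le> t\<close> by simp
        qed
        then have "V (t + \<tau>) - V t \<le> - \<kappa> * \<tau>"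
          using drop[of t "t + \<tau>" \<kappa>] s(1) \<open>s \<le> t\<close> pos by simp
        moreover have "V t \<le> V s" using antimono s(1) \<open>s \<le> t\<close> by simp
        moreover have "l \<le> V (t + \<tau>)" using l s(1) \<open>s \<le> t\<close> pos by simp
        ultimately show False using s(2) by simp
      qed
    qed
  qed
qed

lemma bounded_linear_error_dynamics: "bounded_linear (error_dynamics adj num m app)"
  unfolding error_dynamics_def case_prod_beta
  by (intro bounded_linear_Pair bounded_linear_add bounded_linear_minus
      bounded_linear_compose[OF matrix_vector_mul_bounded_linear]
      bounded_linear_fst bounded_linear_snd)

text \<open>Along a bounded trajectory a bounded linear field is bounded, and with it the
  derivative.\<close>

lemma lipschitz_of_bounded_solution:
  fixes F :: "'a::real_normed_vector \<Rightarrow> 'a" and z :: "real \<Rightarrow> 'a"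
  assumes F: "bounded_linear F" and ode: "solves_ode_on F z S" and "convex S"
    and bound: "\<And>t. t \<in> S \<Longrightarrow> norm (z t) \<le> R"
  obtains C where "C-lipschitz_on S z"
proof -
  obtain D where D: "0 < D" "\<And>y. norm (F y) \<le> norm y * D"
    using bounded_linear.pos_bounded[OF F] by blast
  \<comment> \<open>The absolute value keeps \<open>C\<close> nonnegative even for empty
    \<open>S\<close>, where \<open>R\<close> may be negative.\<close>
  define C where "C = \<bar>R\<bar> * D"
  have "C-lipschitz_on S z"
  proof (rule bounded_derivative_imp_lipschitz[OF _ \<open>convex S\<close>])
    fix t assume t: "t \<in> S"
    show "(z has_derivative (\<lambda>h. h *\<^sub>R F (z t))) (at t within S)"
      using ode t by (simp add: solves_ode_on_def has_vector_derivative_def)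
    have "norm (F (z t)) \<le> norm (z t) * D" by (rule D)
    also have "\<dots> \<le> C" unfolding C_def using bound[OF t] D by (intro mult_right_mono) auto
    finally have "norm (F (z t)) \<le> C" .
    then show "onorm (\<lambda>h. h *\<^sub>R F (z t)) \<le> C"
      by (simp add: onorm_scaleR_left[OF bounded_linear_ident] onorm_id)
  next
    show "0 \<le> C" using D by (simp add: C_def)
  qed
  then show thesis by (rule that)
qed

section \<open>Stability and convergence of the error dynamics\<close>

theorem theorem1:
  fixes adj :: "'n::finite \<Rightarrow> 'n \<Rightarrow> bool"
    and num :: "'n \<Rightarrow> nat"
    and m :: nat
    and app :: "'n \<Rightarrow> nat \<Rightarrow> bool"
    and c :: "nat \<Rightarrow> real"
  assumes graph: "connected_simple_graph adj"
    and numbering: "bij_betw num UNIV {1..CARD('n)}"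
    and m: "1 \<le> m" "m \<le> CARD('n)"
    and applied: "\<forall>h\<in>{1..m}. \<exists>i. app i h"
  shows
    "(\<forall>x0 \<xi>0 x \<xi>. multiagent_solution adj m app c x0 \<xi>0 x \<xi> \<longrightarrow>
        (let \<delta> = (\<lambda>t. x t - input_average num m app c *\<^sub>R 1);
             e = (\<lambda>t. \<xi> t - pseudoinverse (laplacian adj) *v
                              (Lc num m app *v (K2 num m app *v input_vector num m c)))
         in solves_ode_on (error_dynamics adj num m app) (\<lambda>t. (\<delta> t, e t)) {0..}))
     \<and> lyapunov_stable (error_dynamics adj num m app) (0, 0)
     \<and> (\<forall>\<delta>0 e0 \<delta> e. \<delta> 0 = \<delta>0 \<and> e 0 = e0 \<and>
          solves_ode_on (error_dynamics adj num m app) (\<lambda>t. (\<delta> t, e t)) {0..} \<longrightarrow>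
          (\<delta> \<longlongrightarrow> 0) at_top)"
proof -
  let ?F = "error_dynamics adj num m app"
  have sym: "\<And>i j. adj i j \<Longrightarrow> adj j i"
    using graph by (auto simp: connected_simple_graph_def)
  \<comment> \<open>Input 1 exists because \<open>1 \<le> m\<close>; its recipient \<open>k\<close>
    makes \<open>K1\<close> nonzero.\<close>
  obtain k where k: "app k 1" using applied m(1) by (meson atLeastAtMost_iff order_refl)
  have one: "1 \<in> {1..m}" using m(1) by simp
  obtain \<mu> where \<mu>: "0 < \<mu>"
    "\<And>x. \<mu> * (norm x)\<^sup>2 \<le> x \<bullet> ((laplacian adj + K1 num m app) *v x)"
    using matrix_coercive laplacian_plus_K1_pos[where adj = adj and app = app, OF graph numbering m(2) one k]
    by blast
  have energy: "z \<bullet> ?F z \<le> - \<mu> * (norm (fst z))\<^sup>2" for z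
    using \<mu>(2)[of "fst z"] error_dynamics_energy[of adj z num m app] sym by simp
  have "- \<mu> * (norm (fst z))\<^sup>2 \<le> 0" for z :: "(real^'n) \<times> (real^'n)"
    using \<mu>(1) by simp
  then have diss: "z \<bullet> ?F z \<le> 0" for z
    using energy order_trans by blast
  have stable: "lyapunov_stable ?F (0, 0)"
    unfolding lyapunov_stable_def
  proof (intro conjI allI impI)
    show "?F (0, 0) = 0"
      by (simp add: error_dynamics_def zero_prod_def)
  next
    fix \<epsilon> :: real assume "0 < \<epsilon>"
    \<comment> \<open>As norms never grow, \<eta> = \<epsilon> works.\<close>
    have "dist (z t) (0, 0) < \<epsilon>"
      if "solves_ode_on ?F z {0..T}" "dist (z 0) (0, 0) < \<epsilon>" "t \<in> {0..T}" for T z t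
      using norm_antimono_of_dissipative[OF that(1) diss, of 0 t] that(2,3)
      by (simp add: zero_prod_def[symmetric])
    then show "\<exists>\<eta>>0. \<forall>T\<ge>0. \<forall>z. solves_ode_on ?F z {0..T} \<and> dist (z 0) (0, 0) < \<eta> \<longrightarrow>
        (\<forall>t\<in>{0..T}. dist (z t) (0, 0) < \<epsilon>)"
      using \<open>0 < \<epsilon>\<close> by blast
  qed
  have conv: "(\<delta> \<longlongrightarrow> 0) at_top" if ode: "solves_ode_on ?F (\<lambda>t. (\<delta> t, e t)) {0..}" for \<delta> e
  proof -
    let ?z = "\<lambda>t. (\<delta> t, e t)"
    have "norm (?z t) \<le> norm (?z 0)" if "t \<in> {0..}" for t
      using norm_antimono_of_dissipative[OF ode diss, of 0 t] that by simp
    then obtain C where C: "C-lipschitz_on {0..} ?z"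
      using lipschitz_of_bounded_solution[OF bounded_linear_error_dynamics ode] by auto
    show ?thesis
    proof (rule tendsto_zero_of_lyapunov)
      show "((\<lambda>t. (norm (?z t))\<^sup>2) has_real_derivative 2 * (?z t \<bullet> ?F (?z t))) (at t within {0..})"
        if "0 \<le> t" for t
        using solves_ode_on_norm_derivative[OF ode] that by simp
      show "2 * (?z t \<bullet> ?F (?z t)) \<le> - (2 * \<mu>) * (norm (\<delta> t))\<^sup>2" for t
        using energy[of "?z t"] by simp
      \<comment> \<open>Distances in the first component are at most those of the pair.\<close>
      show "C-lipschitz_on {0..} \<delta>"
        using C by (auto intro!: lipschitz_onI lipschitz_on_nonneg[OF C]
            intro: order_trans[OF _ lipschitz_onD[OF C]] simp: dist_Pair_Pair)
    qed (use \<mu> in auto)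
  qed
  show ?thesis
    using error_dynamics_of_solution[where adj = adj and app = app, OF graph numbering m(2) one k]
      stable conv
    by (auto simp: Let_def)
qed

end
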